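(* Let $\mathsf{C}$ be a category. Then the corestriction to $\mathrm{SGCgr}(\mathsf{C})$ of the mapping $(\cdot)^{\natural}\colon\mathrm{RCgr}(\mathsf{C})\to\mathrm{GCgr}(\mathsf{C})$ is a functor from $\mathsf{RCgr}(\mathsf{C})$ to $\mathsf{SGCgr}(\mathsf{C})$, and it has a right adjoint $(\cdot)^{\flat}$.
   Context: A Riguet congruence on a category $\mathsf{C}$ is a pair $\Phi=(\Phi^{\mathrm{ob}},\Phi^{\mathrm{fl}})$ where $\Phi^{\mathrm{ob}}$ is an equivalence relation on $\mathrm{Ob}(\mathsf{C})$ and $\Phi^{\mathrm{fl}}$ assigns to all $(a,a'),(b,b')\in\Phi^{\mathrm{ob}}$ a subset $\Phi^{\mathrm{fl}}_{\left(\begin{smallmatrix}a&b\\ a'&b'\end{smallmatrix}\right)}\subseteq\mathrm{Hom}_{\mathsf{C}}(a,b)\times\mathrm{Hom}_{\mathsf{C}}(a',b')$ such that: (Ra) if $(a,b)\in\Phi^{\mathrm{ob}}$, then $(\mathrm{id}_a,\mathrm{id}_b)\in\Phi^{\mathrm{fl}}_{\left(\begin{smallmatrix}a&a\\ b&b\end{smallmatrix}\right)}$; (Rb) if $f\in\mathrm{Hom}_{\mathsf{C}}(a,b)$, then $(f,f)\in\Phi^{\mathrm{fl}}_{\left(\begin{smallmatrix}a&b\\ a&b\end{smallmatrix}\right)}$; (Rc) if $(f,f')\in\Phi^{\mathrm{fl}}_{\left(\begin{smallmatrix}a&b\\ a'&b'\end{smallmatrix}\right)}$, then $(f',f)\in\Phi^{\mathrm{fl}}_{\left(\begin{smallmatrix}a'&b'\\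 a&b\end{smallmatrix}\right)}$; (Rd) if $(f,f')\in\Phi^{\mathrm{fl}}_{\left(\begin{smallmatrix}a&b\\ a'&b'\end{smallmatrix}\right)}$ and $(f',f'')\in\Phi^{\mathrm{fl}}_{\left(\begin{smallmatrix}a'&b'\\ a''&b''\end{smallmatrix}\right)}$, then $(f,f'')\in\Phi^{\mathrm{fl}}_{\left(\begin{smallmatrix}a&b\\ a''&b''\end{smallmatrix}\right)}$; (Re) if $(f,f')\in\Phi^{\mathrm{fl}}_{\left(\begin{smallmatrix}a&b\\ a'&b'\end{smallmatrix}\right)}$ and $(g,g')\in\Phi^{\mathrm{fl}}_{\left(\begin{smallmatrix}b&c\\ b'&c'\end{smallmatrix}\right)}$, then $(g\circ f,g'\circ f')\in\Phi^{\mathrm{fl}}_{\left(\begin{smallmatrix}a&c\\ a'&c'\end{smallmatrix}\right)}$; (Rf) for all $(a,a'),(b,b')\in\Phi^{\mathrm{ob}}$ and $f\in\mathrm{Hom}_{\mathsf{C}}(a,b)$ there is $f'\in\mathrm{Hom}_{\mathsf{C}}(a',b')$ with $(f,f')\in\Phi^{\mathrm{fl}}_{\left(\begin{smallmatrix}a&b\\ a'&b'\end{smallmatrix}\right)}$. Let $\mathrm{sc}(f)$, $\mathrm{tg}(f)$ be the source and target of a morphism $f$, let $\mathrm{Mor}(\mathsf{C})^{+}$ be the set of finite nonempty sequences $(f_i)_{i\in m}=(f_0,\dots,f_{m-1})$ of morphisms of $\mathsf{C}$, let $(f)$ be the length-one sequence, and let $\curlywedge$ be concatenation. For an equivalence relation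 $E$ on $\mathrm{Ob}(\mathsf{C})$, $\mathrm{Mor}(\mathsf{C})^{+}_{E}$ is the set of $E$-composable sequences: those $(f_i)_{i\in m}$ with $(\mathrm{tg}(f_i),\mathrm{sc}(f_{i+1}))\in E$ for every $i\in m-1$. A generalized congruence on $\mathsf{C}$ is a pair $\Psi=(\Psi^{\mathrm{ob}},\Psi^{\mathrm{fl}})$ where $\Psi^{\mathrm{ob}}$ is an equivalence relation on $\mathrm{Ob}(\mathsf{C})$ and $\Psi^{\mathrm{fl}}$ is an equivalence relation on $\mathrm{Mor}(\mathsf{C})^{+}_{\Psi^{\mathrm{ob}}}$ such that: (a) if $(a,b)\in\Psi^{\mathrm{ob}}$, then $((\mathrm{id}_a),(\mathrm{id}_b))\in\Psi^{\mathrm{fl}}$; (b) if $((f_i)_{i\in m},(g_j)_{j\in n})\in\Psi^{\mathrm{fl}}$, then $(\mathrm{sc}(f_0),\mathrm{sc}(g_0))\in\Psi^{\mathrm{ob}}$ and $(\mathrm{tg}(f_{m-1}),\mathrm{tg}(g_{n-1}))\in\Psi^{\mathrm{ob}}$; (c) if $\mathrm{sc}(g)=\mathrm{tg}(f)$, then $((f,g),(g\circ f))\in\Psi^{\mathrm{fl}}$; (d) if $((f_i)_{i\in m},(f'_{i'})_{i'\in m'}),((g_j)_{j\in n},(g'_{j'})_{j'\in n'})\in\Psi^{\mathrm{fl}}$ and $(\mathrm{tg}(f_{m-1}),\mathrm{sc}(g_0))\in\Psi^{\mathrm{ob}}$, then $((f_i)_{i\in m}\curlywedge(g_j)_{j\in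 n},(f'_{i'})_{i'\in m'}\curlywedge(g'_{j'})_{j'\in n'})\in\Psi^{\mathrm{fl}}$. $\Psi$ is strong if, for all $(a,a'),(b,b')\in\Psi^{\mathrm{ob}}$ and $f\in\mathrm{Hom}_{\mathsf{C}}(a,b)$, there is $f'\in\mathrm{Hom}_{\mathsf{C}}(a',b')$ with $((f),(f'))\in\Psi^{\mathrm{fl}}$. $\mathrm{RCgr}(\mathsf{C})$, $\mathrm{GCgr}(\mathsf{C})$, $\mathrm{SGCgr}(\mathsf{C})$ are the sets of Riguet, generalized, and strong generalized congruences on $\mathsf{C}$, ordered by coordinatewise inclusion; $\mathsf{RCgr}(\mathsf{C})$ and $\mathsf{SGCgr}(\mathsf{C})$ are the categories associated to the ordered sets $(\mathrm{RCgr}(\mathsf{C}),\subseteq)$ and $(\mathrm{SGCgr}(\mathsf{C}),\subseteq)$. For a Riguet congruence $\Phi$, $\Phi^{\natural}$ is the smallest generalized congruence $\Psi$ on $\mathsf{C}$ such that $\Phi^{\mathrm{ob}}\subseteq\Psi^{\mathrm{ob}}$ and $((f),(f'))\in\Psi^{\mathrm{fl}}$ whenever $(f,f')$ lies in some component of $\Phi^{\mathrm{fl}}$; it satisfies $\Phi^{\natural\mathrm{ob}}=\Phi^{\mathrm{ob}}$ and is strong. *)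

theory Defs
  imports Main
begin

record ('o, 'm) cat =
  Ob :: "'o set"
  Mor :: "'m set"
  sc :: "'m \<Rightarrow> 'o"
  tg :: "'m \<Rightarrow> 'o"
  idm :: "'o \<Rightarrow> 'm"
  cmp :: "'m \<Rightarrow> 'm \<Rightarrow> 'm"  (infixr \<open>\<odot>\<index>\<close> 70)

text \<open>\<open>g \<odot>\<^bsub>C\<^esub> f\<close> is \<open>g\<close> after \<open>f\<close>; only its values for \<open>sc C g = tg C f\<close> matter.\<close>

definition Hom :: "('o, 'm) cat \<Rightarrow> 'o \<Rightarrow> 'o \<Rightarrow> 'm set" where
  "Hom C a b = {f \<in> Mor C. sc C f = a \<and> tg C f = b}"

locale category =
  fixes C :: "('o, 'm) cat" (structure)
  assumes sc_in: "f \<in> Mor C \<Longrightarrow> sc C f \<in> Ob C"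
    and tg_in: "f \<in> Mor C \<Longrightarrow> tg C f \<in> Ob C"
    and idm_in: "a \<in> Ob C \<Longrightarrow> idm C a \<in> Hom C a a"
    and cmp_in: "\<lbrakk>f \<in> Hom C a b; g \<in> Hom C b c\<rbrakk> \<Longrightarrow> g \<odot> f \<in> Hom C a c"
    and cmp_idm: "f \<in> Hom C a b \<Longrightarrow> f \<odot> idm C a = f"
    and idm_cmp: "f \<in> Hom C a b \<Longrightarrow> idm C b \<odot> f = f"
    and cmp_assoc: "\<lbrakk>f \<in> Hom C a b; g \<in> Hom C b c; h \<in> Hom C c d\<rbrakk>
      \<Longrightarrow> (h \<odot> g) \<odot> f = h \<odot> (g \<odot> f)"

record ('o, 'm, 'p, 'n) fctr =
  obmap :: "'o \<Rightarrow> 'p"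
  mormap :: "'m \<Rightarrow> 'n"

locale cat_functor = dom: category A + cod: category B
  for A :: "('o, 'm) cat" and B :: "('p, 'n) cat" and F :: "('o, 'm, 'p, 'n) fctr" +
  assumes obmap_in: "a \<in> Ob A \<Longrightarrow> obmap F a \<in> Ob B"
    and mormap_in: "f \<in> Hom A a a' \<Longrightarrow> mormap F f \<in> Hom B (obmap F a) (obmap F a')"
    and mormap_idm: "a \<in> Ob A \<Longrightarrow> mormap F (idm A a) = idm B (obmap F a)"
    and mormap_cmp: "\<lbrakk>f \<in> Hom A a a'; g \<in> Hom A a' a''\<rbrakk>
      \<Longrightarrow> mormap F (g \<odot>\<^bsub>A\<^esub> f) = mormap F g \<odot>\<^bsub>B\<^esub> mormap F f"

locale adjunction = L: cat_functor A B F + R: cat_functor B A G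
  for A :: "('o, 'm) cat" and B :: "('p, 'n) cat"
    and F :: "('o, 'm, 'p, 'n) fctr" and G :: "('p, 'n, 'o, 'm) fctr" +
  fixes \<phi> :: "'o \<Rightarrow> 'p \<Rightarrow> 'n \<Rightarrow> 'm"
  assumes bij: "\<lbrakk>a \<in> Ob A; b \<in> Ob B\<rbrakk>
      \<Longrightarrow> bij_betw (\<phi> a b) (Hom B (obmap F a) b) (Hom A a (obmap G b))"
    and natural: "\<lbrakk>h \<in> Hom A a' a; f \<in> Hom B (obmap F a) b; k \<in> Hom B b b'\<rbrakk>
      \<Longrightarrow> \<phi> a' b' (k \<odot>\<^bsub>B\<^esub> f \<odot>\<^bsub>B\<^esub> mormap F h) = mormap G k \<odot>\<^bsub>A\<^esub> \<phi> a b f \<odot>\<^bsub>A\<^esub> h"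

definition is_right_adjoint ::
  "('o, 'm) cat \<Rightarrow> ('p, 'n) cat \<Rightarrow> ('o, 'm, 'p, 'n) fctr \<Rightarrow> ('p, 'n, 'o, 'm) fctr \<Rightarrow> bool" where
  "is_right_adjoint A B F G \<longleftrightarrow> (\<exists>\<phi>. adjunction A B F G \<phi>)"

text \<open>The category associated to a set \<open>X\<close> ordered by \<open>le\<close>: there is exactly one morphism
  \<open>x \<rightarrow> y\<close>, namely \<open>(x, y)\<close>, if \<open>le x y\<close>, and none otherwise.\<close>

definition order_cat :: "'a set \<Rightarrow> ('a \<Rightarrow> 'a \<Rightarrow> bool) \<Rightarrow> ('a, 'a \<times> 'a) cat" where
  "order_cat X le = \<lparr>Ob = X, Mor = {(x, y). x \<in> X \<and> y \<in> X \<and> le x y}, sc = fst, tg = snd,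
     idm = (\<lambda>x. (x, x)), cmp = (\<lambda>g f. (fst f, snd g))\<rparr>"

text \<open>A mapping between ordered sets determines the only candidate for the morphism part of a
  functor between the associated categories.\<close>

definition order_map :: "('a \<Rightarrow> 'b) \<Rightarrow> ('a, 'a \<times> 'a, 'b, 'b \<times> 'b) fctr" where
  "order_map F = \<lparr>obmap = F, mormap = map_prod F F\<rparr>"

text \<open>\<open>snd \<Phi> a b a' b'\<close> is the component of the second coordinate of \<open>\<Phi>\<close> at the matrix with
  rows \<open>a b\<close> and \<open>a' b'\<close>.  Since the family is only indexed by \<open>(a, a'), (b, b') \<in> fst \<Phi>\<close>, the
  total function representing it is normalised to be empty elsewhere, so that equality of
  HOL terms is equality of families.\<close>

type_synonym ('o, 'm) rcgr = "'o rel \<times> ('o \<Rightarrow> 'o \<Rightarrow> 'o \<Rightarrow> 'o \<Rightarrow> 'm rel)"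

definition riguet :: "('o, 'm) cat \<Rightarrow> ('o, 'm) rcgr \<Rightarrow> bool" where
  "riguet C = (\<lambda>(E, R).
     equiv (Ob C) E \<and>
     (\<forall>a b a' b'. (a, a') \<in> E \<and> (b, b') \<in> E \<longrightarrow> R a b a' b' \<subseteq> Hom C a b \<times> Hom C a' b') \<and>
     (\<forall>a b a' b'. \<not> ((a, a') \<in> E \<and> (b, b') \<in> E) \<longrightarrow> R a b a' b' = {}) \<and>
     (\<forall>a b. (a, b) \<in> E \<longrightarrow> (idm C a, idm C b) \<in> R a a b b) \<and>
     (\<forall>a b f. a \<in> Ob C \<and> b \<in> Ob C \<and> f \<in> Hom C a b \<longrightarrow> (f, f) \<in> R a b a b) \<and>
     (\<forall>a b a' b' f f'. (f, f') \<in> R a b a' b' \<longrightarrow> (f', f) \<in> R a' b' a b) \<and>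
     (\<forall>a b a' b' a'' b'' f f' f''.
        (f, f') \<in> R a b a' b' \<and> (f', f'') \<in> R a' b' a'' b'' \<longrightarrow> (f, f'') \<in> R a b a'' b'') \<and>
     (\<forall>a b c a' b' c' f f' g g'.
        (f, f') \<in> R a b a' b' \<and> (g, g') \<in> R b c b' c'
          \<longrightarrow> (g \<odot>\<^bsub>C\<^esub> f, g' \<odot>\<^bsub>C\<^esub> f') \<in> R a c a' c') \<and>
     (\<forall>a b a' b'. (a, a') \<in> E \<and> (b, b') \<in> E
        \<longrightarrow> (\<forall>f \<in> Hom C a b. \<exists>f' \<in> Hom C a' b'. (f, f') \<in> R a b a' b')))"

definition RCgr :: "('o, 'm) cat \<Rightarrow> ('o, 'm) rcgr set" where
  "RCgr C = {\<Phi>. riguet C \<Phi>}"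

definition rcgr_le :: "('o, 'm) rcgr \<Rightarrow> ('o, 'm) rcgr \<Rightarrow> bool" where
  "rcgr_le \<Phi> \<Phi>' \<longleftrightarrow> fst \<Phi> \<subseteq> fst \<Phi>' \<and>
     (\<forall>a b a' b'. (a, a') \<in> fst \<Phi> \<and> (b, b') \<in> fst \<Phi> \<longrightarrow> snd \<Phi> a b a' b' \<subseteq> snd \<Phi>' a b a' b')"

definition RCgr_cat :: "('o, 'm) cat \<Rightarrow> (('o, 'm) rcgr, ('o, 'm) rcgr \<times> ('o, 'm) rcgr) cat" where
  "RCgr_cat C = order_cat (RCgr C) rcgr_le"

definition composable :: "('o, 'm) cat \<Rightarrow> 'o rel \<Rightarrow> 'm list set" where
  "composable C E = {fs. fs \<noteq> [] \<and> set fs \<subseteq> Mor C \<and>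
     (\<forall>i. Suc i < length fs \<longrightarrow> (tg C (fs ! i), sc C (fs ! Suc i)) \<in> E)}"

text \<open>A nonempty list \<open>[f\<^sub>0, \<dots>, f\<^sub>n]\<close> is read in diagrammatic order: \<open>f\<^sub>0\<close> comes first.\<close>

type_synonym ('o, 'm) gcgr = "'o rel \<times> 'm list rel"

definition gen_congruence :: "('o, 'm) cat \<Rightarrow> ('o, 'm) gcgr \<Rightarrow> bool" where
  "gen_congruence C = (\<lambda>(E, R).
     equiv (Ob C) E \<and>
     equiv (composable C E) R \<and>
     (\<forall>a b. (a, b) \<in> E \<longrightarrow> ([idm C a], [idm C b]) \<in> R) \<and>
     (\<forall>fs gs. (fs, gs) \<in> R \<longrightarrow>
        (sc C (hd fs), sc C (hd gs)) \<in> E \<and> (tg C (last fs), tg C (last gs)) \<in> E) \<and>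
     (\<forall>f \<in> Mor C. \<forall>g \<in> Mor C. sc C g = tg C f \<longrightarrow> ([f, g], [g \<odot>\<^bsub>C\<^esub> f]) \<in> R) \<and>
     (\<forall>fs fs' gs gs'. (fs, fs') \<in> R \<and> (gs, gs') \<in> R \<and> (tg C (last fs), sc C (hd gs)) \<in> E
        \<longrightarrow> (fs @ gs, fs' @ gs') \<in> R))"

definition strong :: "('o, 'm) cat \<Rightarrow> ('o, 'm) gcgr \<Rightarrow> bool" where
  "strong C \<Psi> \<longleftrightarrow>
     (\<forall>a b a' b'. (a, a') \<in> fst \<Psi> \<and> (b, b') \<in> fst \<Psi>
        \<longrightarrow> (\<forall>f \<in> Hom C a b. \<exists>f' \<in> Hom C a' b'. ([f], [f']) \<in> snd \<Psi>))"

definition GCgr :: "('o, 'm) cat \<Rightarrow> ('o, 'm) gcgr set" where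
  "GCgr C = {\<Psi>. gen_congruence C \<Psi>}"

definition SGCgr :: "('o, 'm) cat \<Rightarrow> ('o, 'm) gcgr set" where
  "SGCgr C = {\<Psi> \<in> GCgr C. strong C \<Psi>}"

definition gcgr_le :: "('o, 'm) gcgr \<Rightarrow> ('o, 'm) gcgr \<Rightarrow> bool" where
  "gcgr_le \<Psi> \<Psi>' \<longleftrightarrow> fst \<Psi> \<subseteq> fst \<Psi>' \<and> snd \<Psi> \<subseteq> snd \<Psi>'"

definition SGCgr_cat :: "('o, 'm) cat \<Rightarrow> (('o, 'm) gcgr, ('o, 'm) gcgr \<times> ('o, 'm) gcgr) cat" where
  "SGCgr_cat C = order_cat (SGCgr C) gcgr_le"

definition extends :: "('o, 'm) rcgr \<Rightarrow> ('o, 'm) gcgr \<Rightarrow> bool" where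
  "extends \<Phi> \<Psi> \<longleftrightarrow> fst \<Phi> \<subseteq> fst \<Psi> \<and>
     (\<forall>a b a' b' f f'. (a, a') \<in> fst \<Phi> \<and> (b, b') \<in> fst \<Phi> \<and> (f, f') \<in> snd \<Phi> a b a' b'
        \<longrightarrow> ([f], [f']) \<in> snd \<Psi>)"

definition is_smallest_extension ::
  "('o, 'm) cat \<Rightarrow> ('o, 'm) rcgr \<Rightarrow> ('o, 'm) gcgr \<Rightarrow> bool" where
  "is_smallest_extension C \<Phi> \<Psi> \<longleftrightarrow> \<Psi> \<in> GCgr C \<and> extends \<Phi> \<Psi> \<and>
     (\<forall>\<Psi>' \<in> GCgr C. extends \<Phi> \<Psi>' \<longrightarrow> gcgr_le \<Psi> \<Psi>')"

text \<open>\<open>natural_gcgr C \<Phi>\<close> is \<open>\<Phi>\<^sup>\<natural>\<close>.  The smallest element, if there is one, is unique because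
  \<open>gcgr_le\<close> is antisymmetric; it exists for every Riguet congruence \<open>\<Phi>\<close> on a category.\<close>

definition natural_gcgr :: "('o, 'm) cat \<Rightarrow> ('o, 'm) rcgr \<Rightarrow> ('o, 'm) gcgr" where
  "natural_gcgr C \<Phi> = (THE \<Psi>. is_smallest_extension C \<Phi> \<Psi>)"

end

theory Submission
  imports Defs
begin

text \<open>
  Between ordered sets, adjoint functors are the same thing as a Galois connection, so it is
  enough to find for every strong generalized congruence \<open>\<Psi>\<close> a Riguet congruence \<open>\<Psi>\<^sup>\<flat>\<close> with
  \<open>\<Phi>\<^sup>\<natural> \<subseteq> \<Psi> \<longleftrightarrow> \<Phi> \<subseteq> \<Psi>\<^sup>\<flat>\<close> for all \<open>\<Phi>\<close>.  Both sides turn out to say the same, namely that \<open>\<Psi>\<close> extends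
  \<open>\<Phi>\<close>: the left one because \<open>\<Phi>\<^sup>\<natural>\<close> is the smallest extension, the right one if \<open>\<Psi>\<^sup>\<flat>\<close> is obtained by
  restricting \<open>\<Psi>\<close> to sequences of length one (\<open>extends_iff_le_flat\<close>).  This restriction satisfies
  (Re) because \<open>(f, g)\<close> and \<open>(g \<circ> f)\<close> are related in \<open>\<Psi>\<close>, and (Rf) is exactly strength.

  What remains is that \<open>\<Phi>\<^sup>\<natural>\<close> exists and is strong.  Generalized congruences are closed under
  nonempty intersections, so the smallest extension exists as soon as one extension does.  One is
  given by the coarsest generalized congruence with object part \<open>\<Phi>\<^sup>o\<^sup>b\<close>, which identifies two
  composable sequences whenever their end points are equivalent (\<open>coarse\<close>).  Its existence
  also bounds the object part of \<open>\<Phi>\<^sup>\<natural>\<close> by \<open>\<Phi>\<^sup>o\<^sup>b\<close>, and then (Rf) for \<open>\<Phi>\<close> makes \<open>\<Phi>\<^sup>\<natural>\<close> strong.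
\<close>

section \<open>Galois connections as adjunctions\<close>

lemma Hom_order_cat:
  "f \<in> Hom (order_cat X le) a b \<longleftrightarrow> f = (a, b) \<and> a \<in> X \<and> b \<in> X \<and> le a b"
  by (cases f) (auto simp: Hom_def order_cat_def)

lemma category_order_cat:
  assumes "\<And>x. x \<in> X \<Longrightarrow> le x x"
    and "\<And>x y z. \<lbrakk>x \<in> X; y \<in> X; z \<in> X; le x y; le y z\<rbrakk> \<Longrightarrow> le x z"
  shows "category (order_cat X le)"
proof unfold_locales
  fix f a b g c
  assume "f \<in> Hom (order_cat X le) a b" "g \<in> Hom (order_cat X le) b c"
  then show "g \<odot>\<^bsub>order_cat X le\<^esub> f \<in> Hom (order_cat X le) a c"
    unfolding Hom_order_cat using assms(2)[of a b c] by (simp add: order_cat_def)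
qed (simp_all add: Hom_order_cat, auto simp: order_cat_def assms(1))

lemma cat_functor_order_map:
  assumes "category (order_cat X le)" and "category (order_cat Y le')"
    and "\<And>x. x \<in> X \<Longrightarrow> F x \<in> Y"
    and "\<And>x x'. \<lbrakk>x \<in> X; x' \<in> X; le x x'\<rbrakk> \<Longrightarrow> le' (F x) (F x')"
  shows "cat_functor (order_cat X le) (order_cat Y le') (order_map F)"
  using assms(1,2)
  by (intro cat_functor.intro cat_functor_axioms.intro)
     (use assms(3,4) in \<open>auto simp: Hom_order_cat order_map_def\<close>, auto simp: order_cat_def)

text \<open>The unit and counit inequalities of a Galois connection make both maps monotone, and the
  bijections between Hom sets are bijections between sets with at most one element; all equations
  between morphisms of an ordered set, naturality included, hold because their sides are
  parallel.\<close>

lemma is_right_adjoint_order_map: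
  assumes A: "category (order_cat X le)" and B: "category (order_cat Y le')"
    and F: "\<And>x. x \<in> X \<Longrightarrow> F x \<in> Y" and G: "\<And>y. y \<in> Y \<Longrightarrow> G y \<in> X"
    and galois: "\<And>x y. \<lbrakk>x \<in> X; y \<in> Y\<rbrakk> \<Longrightarrow> le' (F x) y \<longleftrightarrow> le x (G y)"
  shows "is_right_adjoint (order_cat X le) (order_cat Y le') (order_map F) (order_map G)"
proof -
  have refl: "le x x" if "x \<in> X" for x
    using category.idm_in[OF A, of x] that by (simp add: Hom_order_cat) (simp add: order_cat_def)
  have refl': "le' y y" if "y \<in> Y" for y
    using category.idm_in[OF B, of y] that by (simp add: Hom_order_cat) (simp add: order_cat_def)
  have trans: "le x z" if "x \<in> X" "y \<in> X" "z \<in> X" "le x y" "le y z" for x y z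
    using category.cmp_in[OF A, of "(x, y)" x y "(y, z)" z] that by (simp add: Hom_order_cat)
  have trans': "le' x z" if "x \<in> Y" "y \<in> Y" "z \<in> Y" "le' x y" "le' y z" for x y z
    using category.cmp_in[OF B, of "(x, y)" x y "(y, z)" z] that by (simp add: Hom_order_cat)
  have unit: "le x (G (F x))" if "x \<in> X" for x
    using that galois F refl' by blast
  have counit: "le' (F (G y)) y" if "y \<in> Y" for y
    using that galois G refl by blast
  have mono_F: "le' (F x) (F x')" if "x \<in> X" "x' \<in> X" "le x x'" for x x'
  proof -
    have "le x (G (F x'))"
      using that F G unit by (blast intro: trans)
    then show ?thesis
      using that F galois by blast
  qed
  have mono_G: "le (G y) (G y')" if "y \<in> Y" "y' \<in> Y" "le' y y'" for y y'
  proof -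
    have "le' (F (G y)) y'"
      using that F G counit by (blast intro: trans')
    then show ?thesis
      using that G galois by blast
  qed
  have "adjunction (order_cat X le) (order_cat Y le') (order_map F) (order_map G)
    (\<lambda>x y _. (x, G y))"
  proof (intro adjunction.intro adjunction_axioms.intro cat_functor_order_map A B F G mono_F mono_G)
    fix x y
    assume "x \<in> Ob (order_cat X le)" "y \<in> Ob (order_cat Y le')"
    then have "x \<in> X" "y \<in> Y"
      by (simp_all add: order_cat_def)
    then show "bij_betw (\<lambda>_. (x, G y))
        (Hom (order_cat Y le') (obmap (order_map F) x) y)
        (Hom (order_cat X le) x (obmap (order_map G) y))"
      using galois F G
      by (auto simp: bij_betw_def inj_on_def Hom_order_cat order_map_def image_iff)
  qed (auto simp: Hom_order_cat order_map_def, auto simp: order_cat_def)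
  then show ?thesis
    unfolding is_right_adjoint_def by blast
qed

section \<open>The smallest generalized congruence extending a Riguet congruence\<close>

text \<open>Equivalence of end points is implied by every generalized congruence with object part \<open>E\<close>,
  by condition (b); the relation below is the extreme case where it also suffices.\<close>

definition coarse :: "('o, 'm) cat \<Rightarrow> 'o rel \<Rightarrow> ('o, 'm) gcgr" where
  "coarse C E = (E, {(fs, gs). fs \<in> composable C E \<and> gs \<in> composable C E \<and>
     (sc C (hd fs), sc C (hd gs)) \<in> E \<and> (tg C (last fs), tg C (last gs)) \<in> E})"

lemma composable_single: "[f] \<in> composable C E \<longleftrightarrow> f \<in> Mor C"
  by (simp add: composable_def)

lemma composable_append:
  assumes "fs \<in> composable C E" and "gs \<in> composable C E"
    and "(tg C (last fs), sc C (hd gs)) \<in> E"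
  shows "fs @ gs \<in> composable C E"
proof -
  have "(tg C ((fs @ gs) ! i), sc C ((fs @ gs) ! Suc i)) \<in> E"
    if "Suc i < length (fs @ gs)" for i
  proof (cases "Suc i" "length fs" rule: linorder_cases)
    case equal
    then have "i = length fs - 1"
      by simp
    then show ?thesis
      using assms equal by (auto simp: composable_def nth_append last_conv_nth hd_conv_nth)
  next
    case greater
    then show ?thesis
      using assms(2) that by (auto simp: composable_def nth_append Suc_diff_le)
  qed (use assms(1) in \<open>auto simp: composable_def nth_append\<close>)
  then show ?thesis
    using assms by (auto simp: composable_def)
qed

lemma gen_congruence_coarse:
  assumes "category C" and E: "equiv (Ob C) E"
  shows "gen_congruence C (coarse C E)"
proof -
  interpret category C by fact
  have E_refl: "(a, a) \<in> E" if "a \<in> Ob C" for a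
    using E that by (auto elim: equivE dest: refl_onD)
  have E_sym: "(b, a) \<in> E" if "(a, b) \<in> E" for a b
    using E that by (auto elim: equivE dest: symD)
  have E_trans: "(a, c) \<in> E" if "(a, b) \<in> E" "(b, c) \<in> E" for a b c
    using E that by (auto elim!: equivE dest: transD)
  have E_Ob: "a \<in> Ob C \<and> b \<in> Ob C" if "(a, b) \<in> E" for a b
    using E that by (auto elim!: equivE)
  have idm: "idm C a \<in> Mor C \<and> sc C (idm C a) = a \<and> tg C (idm C a) = a" if "a \<in> Ob C" for a
    using idm_in[OF that] by (simp add: Hom_def)
  have cmp: "g \<odot>\<^bsub>C\<^esub> f \<in> Mor C \<and> sc C (g \<odot>\<^bsub>C\<^esub> f) = sc C f \<and> tg C (g \<odot>\<^bsub>C\<^esub> f) = tg C g"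
    if "f \<in> Mor C" "g \<in> Mor C" "sc C g = tg C f" for f g
    using cmp_in[of f "sc C f" "tg C f" g "tg C g"] that by (simp add: Hom_def)
  have ends: "sc C (hd fs) \<in> Ob C \<and> tg C (last fs) \<in> Ob C" if "fs \<in> composable C E" for fs
    using that by (auto simp: composable_def sc_in tg_in subset_iff)
  have "equiv (composable C E) (snd (coarse C E))"
    by (rule equivI)
       (auto simp: coarse_def refl_on_def sym_def trans_def intro: E_refl E_sym E_trans dest: ends)
  moreover have "([f, g], [g \<odot>\<^bsub>C\<^esub> f]) \<in> snd (coarse C E)"
    if "f \<in> Mor C" "g \<in> Mor C" "sc C g = tg C f" for f g
    using that cmp[OF that] by (auto simp: coarse_def composable_def intro: E_refl sc_in tg_in)
  moreover have "(fs @ gs, fs' @ gs') \<in> snd (coarse C E)"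
    if "(fs, fs') \<in> snd (coarse C E)" "(gs, gs') \<in> snd (coarse C E)"
      "(tg C (last fs), sc C (hd gs)) \<in> E" for fs fs' gs gs'
  proof -
    have "(tg C (last fs'), sc C (hd gs')) \<in> E"
      using that by (auto simp: coarse_def intro: E_trans E_sym)
    moreover have "fs \<noteq> []" "fs' \<noteq> []" "gs \<noteq> []" "gs' \<noteq> []"
      using that by (auto simp: coarse_def composable_def)
    ultimately show ?thesis
      using that by (simp add: coarse_def composable_append)
  qed
  moreover have "([idm C a], [idm C b]) \<in> snd (coarse C E)" if "(a, b) \<in> E" for a b
    using that E_Ob[OF that] idm by (auto simp: coarse_def composable_single)
  ultimately show ?thesis
    using E unfolding gen_congruence_def by (auto simp: coarse_def)
qed

lemma riguet_Hom:
  assumes "riguet C \<Phi>" and "(a, a') \<in> fst \<Phi>" and "(b, b') \<in> fst \<Phi>"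
    and "(f, f') \<in> snd \<Phi> a b a' b'"
  shows "f \<in> Hom C a b" and "f' \<in> Hom C a' b'"
proof -
  have "snd \<Phi> a b a' b' \<subseteq> Hom C a b \<times> Hom C a' b'"
    using assms(1-3) by (simp add: riguet_def split_beta)
  then show "f \<in> Hom C a b" and "f' \<in> Hom C a' b'"
    using assms(4) by auto
qed

lemma extends_coarse:
  assumes "riguet C \<Phi>"
  shows "extends \<Phi> (coarse C (fst \<Phi>))"
proof -
  have "([f], [f']) \<in> snd (coarse C (fst \<Phi>))"
    if "(a, a') \<in> fst \<Phi>" "(b, b') \<in> fst \<Phi>" "(f, f') \<in> snd \<Phi> a b a' b'" for a b a' b' f f'
    using riguet_Hom[OF assms that] that(1,2)
    by (simp add: coarse_def composable_single Hom_def)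
  moreover have "fst (coarse C (fst \<Phi>)) = fst \<Phi>"
    by (simp add: coarse_def)
  ultimately show ?thesis
    unfolding extends_def by blast
qed

lemma equiv_Inter:
  assumes "\<And>i. i \<in> I \<Longrightarrow> equiv (A i) (r i)"
  shows "equiv (\<Inter>i\<in>I. A i) (\<Inter>i\<in>I. r i)"
proof (rule equivI)
  have "r i \<subseteq> A i \<times> A i" if "i \<in> I" for i
    using assms[OF that] by (rule equivE)
  then show "(\<Inter>i\<in>I. r i) \<subseteq> (\<Inter>i\<in>I. A i) \<times> (\<Inter>i\<in>I. A i)"
    by (intro subrelI) blast
  have "refl_on (A i) (r i)" if "i \<in> I" for i
    using assms[OF that] by (rule equivE)
  then show "refl_on (\<Inter>i\<in>I. A i) (\<Inter>i\<in>I. r i)"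
    by (simp add: refl_on_INTER)
  have "sym (r i)" if "i \<in> I" for i
    using assms[OF that] by (rule equivE)
  then show "sym (\<Inter>i\<in>I. r i)"
    by (simp add: sym_INTER)
  have "trans (r i)" if "i \<in> I" for i
    using assms[OF that] by (rule equivE)
  then show "trans (\<Inter>i\<in>I. r i)"
    by (simp add: trans_INTER)
qed

lemma composable_Inter:
  assumes "I \<noteq> {}"
  shows "composable C (\<Inter>i\<in>I. E i) = (\<Inter>i\<in>I. composable C (E i))"
  using assms by (auto simp: composable_def)

definition inter_gcgr :: "('o, 'm) gcgr set \<Rightarrow> ('o, 'm) gcgr" where
  "inter_gcgr S = (\<Inter>\<Psi>\<in>S. fst \<Psi>, \<Inter>\<Psi>\<in>S. snd \<Psi>)"

text \<open>Shrinking the object part also shrinks the set of composable sequences on which the flow part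
  must be reflexive.  Both are cut down at the same rate: the sequences composable for the
  intersection are those composable for every member of the family.\<close>

lemma gen_congruence_inter:
  assumes "S \<noteq> {}" and gen: "\<And>\<Psi>. \<Psi> \<in> S \<Longrightarrow> gen_congruence C \<Psi>"
  shows "gen_congruence C (inter_gcgr S)"
proof -
  have "equiv (Ob C) (\<Inter>\<Psi>\<in>S. fst \<Psi>)"
    using equiv_Inter[of S "\<lambda>_. Ob C" fst] assms by (simp add: gen_congruence_def split_beta)
  moreover have "equiv (composable C (\<Inter>\<Psi>\<in>S. fst \<Psi>)) (\<Inter>\<Psi>\<in>S. snd \<Psi>)"
    unfolding composable_Inter[OF \<open>S \<noteq> {}\<close>]
    by (rule equiv_Inter) (use assms in \<open>simp_all add: gen_congruence_def split_beta\<close>)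
  ultimately show ?thesis
    using gen unfolding gen_congruence_def inter_gcgr_def by (simp add: split_beta)
qed

lemma ex_smallest_extension:
  assumes "\<Psi>\<^sub>0 \<in> GCgr C" and "extends \<Phi> \<Psi>\<^sub>0"
  shows "\<exists>\<Psi>. is_smallest_extension C \<Phi> \<Psi>"
proof -
  let ?S = "{\<Psi> \<in> GCgr C. extends \<Phi> \<Psi>}"
  have "inter_gcgr ?S \<in> GCgr C"
    unfolding GCgr_def mem_Collect_eq
    by (rule gen_congruence_inter) (use assms in \<open>unfold GCgr_def, blast+\<close>)
  moreover have "extends \<Phi> (inter_gcgr ?S)"
    by (force simp: extends_def inter_gcgr_def)
  moreover have "gcgr_le (inter_gcgr ?S) \<Psi>" if "\<Psi> \<in> GCgr C" "extends \<Phi> \<Psi>" for \<Psi>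
    using that by (auto simp: gcgr_le_def inter_gcgr_def)
  ultimately show ?thesis
    unfolding is_smallest_extension_def by blast
qed

lemma smallest_extension_natural:
  assumes "category C" and "riguet C \<Phi>"
  shows "is_smallest_extension C \<Phi> (natural_gcgr C \<Phi>)"
proof -
  have "equiv (Ob C) (fst \<Phi>)"
    using assms(2) by (simp add: riguet_def split_beta)
  then have "\<exists>\<Psi>. is_smallest_extension C \<Phi> \<Psi>"
    using ex_smallest_extension extends_coarse[OF assms(2)] gen_congruence_coarse[OF assms(1)]
    unfolding GCgr_def by blast
  moreover have "\<Psi> = \<Psi>'"
    if "is_smallest_extension C \<Phi> \<Psi>" "is_smallest_extension C \<Phi> \<Psi>'" for \<Psi> \<Psi>'
    using that by (auto simp: is_smallest_extension_def gcgr_le_def intro!: prod_eqI)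
  ultimately show ?thesis
    unfolding natural_gcgr_def by (blast intro: theI)
qed

lemma natural_le_iff_extends:
  assumes "category C" and "riguet C \<Phi>" and "\<Psi> \<in> GCgr C"
  shows "gcgr_le (natural_gcgr C \<Phi>) \<Psi> \<longleftrightarrow> extends \<Phi> \<Psi>"
proof
  assume "gcgr_le (natural_gcgr C \<Phi>) \<Psi>"
  moreover have "extends \<Phi> (natural_gcgr C \<Phi>)"
    using smallest_extension_natural[OF assms(1,2)] by (simp add: is_smallest_extension_def)
  ultimately show "extends \<Phi> \<Psi>"
    unfolding extends_def gcgr_le_def by blast
next
  assume "extends \<Phi> \<Psi>"
  then show "gcgr_le (natural_gcgr C \<Phi>) \<Psi>"
    using smallest_extension_natural[OF assms(1,2)] assms(3)
    by (simp add: is_smallest_extension_def)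
qed

text \<open>Strength asks for lifts along pairs of objects related by \<open>\<Phi>\<^sup>\<natural>\<close>, while (Rf) provides them only
  along pairs related by \<open>\<Phi>\<close>.  Comparing \<open>\<Phi>\<^sup>\<natural>\<close> with the coarse extension shows that these are the
  same pairs.\<close>

lemma natural_in_SGCgr:
  assumes "category C" and rig: "riguet C \<Phi>"
  shows "natural_gcgr C \<Phi> \<in> SGCgr C"
proof -
  have smallest: "is_smallest_extension C \<Phi> (natural_gcgr C \<Phi>)"
    by (rule smallest_extension_natural) fact+
  have "equiv (Ob C) (fst \<Phi>)"
    using rig by (simp add: riguet_def split_beta)
  then have "coarse C (fst \<Phi>) \<in> GCgr C"
    by (simp add: GCgr_def gen_congruence_coarse[OF assms(1)])
  then have "gcgr_le (natural_gcgr C \<Phi>) (coarse C (fst \<Phi>))"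
    using natural_le_iff_extends[OF assms] extends_coarse[OF rig] by blast
  then have ob: "fst (natural_gcgr C \<Phi>) \<subseteq> fst \<Phi>"
    by (simp add: gcgr_le_def coarse_def)
  have "strong C (natural_gcgr C \<Phi>)"
    unfolding strong_def
  proof (intro allI impI ballI)
    fix a b a' b' f
    assume "(a, a') \<in> fst (natural_gcgr C \<Phi>) \<and> (b, b') \<in> fst (natural_gcgr C \<Phi>)"
      and f: "f \<in> Hom C a b"
    then have rel: "(a, a') \<in> fst \<Phi>" "(b, b') \<in> fst \<Phi>"
      using ob by auto
    have "\<forall>a b a' b'. (a, a') \<in> fst \<Phi> \<and> (b, b') \<in> fst \<Phi>
        \<longrightarrow> (\<forall>f\<in>Hom C a b. \<exists>f'\<in>Hom C a' b'. (f, f') \<in> snd \<Phi> a b a' b')"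
      using rig unfolding riguet_def split_beta by (elim conjE)
    then obtain f' where "f' \<in> Hom C a' b'" "(f, f') \<in> snd \<Phi> a b a' b'"
      using rel f by meson
    moreover from this(2) have "([f], [f']) \<in> snd (natural_gcgr C \<Phi>)"
      using smallest rel unfolding is_smallest_extension_def extends_def by blast
    ultimately show "\<exists>f'\<in>Hom C a' b'. ([f], [f']) \<in> snd (natural_gcgr C \<Phi>)"
      by blast
  qed
  then show ?thesis
    using smallest by (simp add: SGCgr_def is_smallest_extension_def)
qed

section \<open>The right adjoint\<close>

definition flat_rcgr :: "('o, 'm) cat \<Rightarrow> ('o, 'm) gcgr \<Rightarrow> ('o, 'm) rcgr" where
  "flat_rcgr C \<Psi> = (fst \<Psi>, \<lambda>a b a' b'. {(f, f'). (a, a') \<in> fst \<Psi> \<and> (b, b') \<in> fst \<Psi> \<and>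
     f \<in> Hom C a b \<and> f' \<in> Hom C a' b' \<and> ([f], [f']) \<in> snd \<Psi>})"

lemma mem_flat_rcgr:
  "(f, f') \<in> snd (flat_rcgr C \<Psi>) a b a' b' \<longleftrightarrow> (a, a') \<in> fst \<Psi> \<and> (b, b') \<in> fst \<Psi> \<and>
     f \<in> Hom C a b \<and> f' \<in> Hom C a' b' \<and> ([f], [f']) \<in> snd \<Psi>"
  by (simp add: flat_rcgr_def)

text \<open>Conditions (c) and (d) speak of sequences, so composites are compared through the sequences
  of length two: \<open>(g \<circ> f)\<close> is related to \<open>(f, g)\<close>, that to \<open>(f', g')\<close>, and that to \<open>(g' \<circ> f')\<close>.\<close>

lemma gen_congruence_cmp:
  assumes gen: "gen_congruence C \<Psi>"
    and f: "f \<in> Hom C a b" "f' \<in> Hom C a' b'" "([f], [f']) \<in> snd \<Psi>"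
    and g: "g \<in> Hom C b c" "g' \<in> Hom C b' c'" "([g], [g']) \<in> snd \<Psi>"
    and b: "(b, b) \<in> fst \<Psi>"
  shows "([g \<odot>\<^bsub>C\<^esub> f], [g' \<odot>\<^bsub>C\<^esub> f']) \<in> snd \<Psi>"
proof -
  have R: "sym (snd \<Psi>)" "trans (snd \<Psi>)"
    using gen by (auto simp: gen_congruence_def split_beta elim: equivE)
  have conds:
    "\<And>f g. \<lbrakk>f \<in> Mor C; g \<in> Mor C; sc C g = tg C f\<rbrakk> \<Longrightarrow> ([f, g], [g \<odot>\<^bsub>C\<^esub> f]) \<in> snd \<Psi>"
    "\<And>fs fs' gs gs'. \<lbrakk>(fs, fs') \<in> snd \<Psi>; (gs, gs') \<in> snd \<Psi>;
      (tg C (last fs), sc C (hd gs)) \<in> fst \<Psi>\<rbrakk> \<Longrightarrow> (fs @ gs, fs' @ gs') \<in> snd \<Psi>"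
    using gen by (auto simp: gen_congruence_def split_beta)
  have "([f, g], [g \<odot>\<^bsub>C\<^esub> f]) \<in> snd \<Psi>" and "([f', g'], [g' \<odot>\<^bsub>C\<^esub> f']) \<in> snd \<Psi>"
    using f g by (auto simp: Hom_def intro: conds(1))
  moreover have "([f, g], [f', g']) \<in> snd \<Psi>"
    using conds(2)[OF f(3) g(3)] f(1) g(1) b by (simp add: Hom_def)
  ultimately show ?thesis
    using R by (meson symD transD)
qed

lemma riguet_flat:
  assumes "category C" and "\<Psi> \<in> SGCgr C"
  shows "riguet C (flat_rcgr C \<Psi>)"
proof -
  interpret category C by fact
  have gen: "gen_congruence C \<Psi>" and str: "strong C \<Psi>"
    using assms(2) by (auto simp: SGCgr_def GCgr_def)
  have E: "equiv (Ob C) (fst \<Psi>)" and R: "equiv (composable C (fst \<Psi>)) (snd \<Psi>)"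
    and ids: "\<And>a b. (a, b) \<in> fst \<Psi> \<Longrightarrow> ([idm C a], [idm C b]) \<in> snd \<Psi>"
    using gen by (auto simp: gen_congruence_def split_beta)
  have E_refl: "(a, a) \<in> fst \<Psi>" if "a \<in> Ob C" for a
    using E that by (auto elim: equivE dest: refl_onD)
  have E_sym: "(b, a) \<in> fst \<Psi>" if "(a, b) \<in> fst \<Psi>" for a b
    using E that by (auto elim: equivE dest: symD)
  have E_trans: "(a, c) \<in> fst \<Psi>" if "(a, b) \<in> fst \<Psi>" "(b, c) \<in> fst \<Psi>" for a b c
    using E that by (auto elim!: equivE dest: transD)
  have E_Ob: "a \<in> Ob C \<and> b \<in> Ob C" if "(a, b) \<in> fst \<Psi>" for a b
    using E that by (auto elim!: equivE)
  have R_refl: "([f], [f]) \<in> snd \<Psi>" if "f \<in> Hom C a b" for f a b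
    using R that by (auto simp: composable_single Hom_def elim!: equivE intro: refl_onD)
  have R_sym: "(gs, fs) \<in> snd \<Psi>" if "(fs, gs) \<in> snd \<Psi>" for fs gs
    using R that by (auto elim: equivE dest: symD)
  have R_trans: "(fs, hs) \<in> snd \<Psi>" if "(fs, gs) \<in> snd \<Psi>" "(gs, hs) \<in> snd \<Psi>" for fs gs hs
    using R that by (auto elim!: equivE dest: transD)
  have ob: "fst (flat_rcgr C \<Psi>) = fst \<Psi>"
    by (simp add: flat_rcgr_def)
  have sub: "snd (flat_rcgr C \<Psi>) a b a' b' \<subseteq> Hom C a b \<times> Hom C a' b'" for a b a' b'
    by (auto simp: mem_flat_rcgr)
  have empty: "snd (flat_rcgr C \<Psi>) a b a' b' = {}"
    if "\<not> ((a, a') \<in> fst \<Psi> \<and> (b, b') \<in> fst \<Psi>)" for a b a' b'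
    using that by (auto simp: mem_flat_rcgr)
  have Ra: "(idm C a, idm C b) \<in> snd (flat_rcgr C \<Psi>) a a b b" if "(a, b) \<in> fst \<Psi>" for a b
    using that E_Ob[OF that] ids by (simp add: mem_flat_rcgr idm_in)
  have Rb: "(f, f) \<in> snd (flat_rcgr C \<Psi>) a b a b"
    if "a \<in> Ob C" "b \<in> Ob C" "f \<in> Hom C a b" for a b f
    using that R_refl E_refl by (simp add: mem_flat_rcgr)
  have Rc: "(f', f) \<in> snd (flat_rcgr C \<Psi>) a' b' a b"
    if "(f, f') \<in> snd (flat_rcgr C \<Psi>) a b a' b'" for a b a' b' f f'
    using that E_sym R_sym by (simp add: mem_flat_rcgr)
  have Rd: "(f, f'') \<in> snd (flat_rcgr C \<Psi>) a b a'' b''"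
    if "(f, f') \<in> snd (flat_rcgr C \<Psi>) a b a' b'" "(f', f'') \<in> snd (flat_rcgr C \<Psi>) a' b' a'' b''"
    for a b a' b' a'' b'' f f' f''
    using that by (auto simp: mem_flat_rcgr intro: E_trans R_trans)
  have Re: "(g \<odot>\<^bsub>C\<^esub> f, g' \<odot>\<^bsub>C\<^esub> f') \<in> snd (flat_rcgr C \<Psi>) a c a' c'"
    if "(f, f') \<in> snd (flat_rcgr C \<Psi>) a b a' b'" "(g, g') \<in> snd (flat_rcgr C \<Psi>) b c b' c'"
    for a b c a' b' c' f f' g g'
    using that E_Ob by (auto simp: mem_flat_rcgr intro: cmp_in E_refl gen_congruence_cmp[OF gen])
  have Rf: "\<exists>f'\<in>Hom C a' b'. (f, f') \<in> snd (flat_rcgr C \<Psi>) a b a' b'"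
    if "(a, a') \<in> fst \<Psi>" "(b, b') \<in> fst \<Psi>" "f \<in> Hom C a b" for a b a' b' f
    using str that unfolding strong_def by (simp add: mem_flat_rcgr)
  show ?thesis
    unfolding riguet_def split_beta ob
    by (intro conjI)
       (fact E, use sub in blast, use empty in blast, use Ra in blast, use Rb in blast,
        use Rc in blast, use Rd in blast, use Re in blast, use Rf in blast)
qed

text \<open>No information about \<open>\<Phi>\<close> is lost when \<open>\<Psi>\<close> is cut down to pairs of parallel length-one
  sequences, since the components of \<open>\<Phi>\<close> consist of pairs of morphisms between prescribed
  objects.\<close>

lemma extends_iff_le_flat:
  assumes "riguet C \<Phi>"
  shows "extends \<Phi> \<Psi> \<longleftrightarrow> rcgr_le \<Phi> (flat_rcgr C \<Psi>)"
proof
  assume ext: "extends \<Phi> \<Psi>"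
  then have ob: "fst \<Phi> \<subseteq> fst \<Psi>"
    by (simp add: extends_def)
  have "(f, f') \<in> snd (flat_rcgr C \<Psi>) a b a' b'"
    if "(a, a') \<in> fst \<Phi>" "(b, b') \<in> fst \<Phi>" "(f, f') \<in> snd \<Phi> a b a' b'" for a b a' b' f f'
  proof -
    have "([f], [f']) \<in> snd \<Psi>"
      using ext that unfolding extends_def by blast
    then show ?thesis
      using riguet_Hom[OF assms that] ob that(1,2) by (auto simp: mem_flat_rcgr)
  qed
  then show "rcgr_le \<Phi> (flat_rcgr C \<Psi>)"
    using ob unfolding rcgr_le_def by (auto simp: flat_rcgr_def)
next
  assume le: "rcgr_le \<Phi> (flat_rcgr C \<Psi>)"
  then have "fst \<Phi> \<subseteq> fst \<Psi>"
    by (simp add: rcgr_le_def flat_rcgr_def)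
  moreover have "([f], [f']) \<in> snd \<Psi>"
    if "(a, a') \<in> fst \<Phi>" "(b, b') \<in> fst \<Phi>" "(f, f') \<in> snd \<Phi> a b a' b'" for a b a' b' f f'
  proof -
    have "(f, f') \<in> snd (flat_rcgr C \<Psi>) a b a' b'"
      using le that unfolding rcgr_le_def by blast
    then show ?thesis
      by (simp add: mem_flat_rcgr)
  qed
  ultimately show "extends \<Phi> \<Psi>"
    unfolding extends_def by blast
qed

section \<open>The adjunction\<close>

lemma category_RCgr_cat: "category (RCgr_cat C)"
  unfolding RCgr_cat_def by (rule category_order_cat) (simp add: rcgr_le_def, unfold rcgr_le_def, blast)

lemma category_SGCgr_cat: "category (SGCgr_cat C)"
  unfolding SGCgr_cat_def by (rule category_order_cat) (auto simp: gcgr_le_def)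

theorem theorem2p42:
  fixes C :: "('o, 'm) cat"
  assumes "category C"
  shows "cat_functor (RCgr_cat C) (SGCgr_cat C) (order_map (natural_gcgr C)) \<and>
    (\<exists>flat. is_right_adjoint (RCgr_cat C) (SGCgr_cat C) (order_map (natural_gcgr C)) flat)"
proof -
  have "gcgr_le (natural_gcgr C \<Phi>) \<Psi> \<longleftrightarrow> rcgr_le \<Phi> (flat_rcgr C \<Psi>)"
    if "\<Phi> \<in> RCgr C" "\<Psi> \<in> SGCgr C" for \<Phi> \<Psi>
    using that natural_le_iff_extends[OF assms] extends_iff_le_flat
    unfolding RCgr_def SGCgr_def by blast
  then have "is_right_adjoint (RCgr_cat C) (SGCgr_cat C) (order_map (natural_gcgr C))
      (order_map (flat_rcgr C))"
    using category_RCgr_cat[of C] category_SGCgr_cat[of C]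
      natural_in_SGCgr[OF assms] riguet_flat[OF assms]
    unfolding RCgr_cat_def SGCgr_cat_def
    by (intro is_right_adjoint_order_map) (simp_all add: RCgr_def)
  \<comment> \<open>The functor law for the left adjoint is part of the adjunction.\<close>
  moreover from this have "cat_functor (RCgr_cat C) (SGCgr_cat C) (order_map (natural_gcgr C))"
    by (auto simp: is_right_adjoint_def adjunction_def)
  ultimately show ?thesis
    by blast
qed

end
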